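(* Let $\delta>0$, let $\bar F_{1,\delta}(x) := \sup\{P(x,\infty) : D_1(P,G_0)\le\delta\}$ for $x\in\mathbb{R}$, and let $F_{1,\delta}(x) := 1-\bar F_{1,\delta}(x)$. Then $F_{1,\delta}$ belongs to the domain of attraction of $G_1$.
   Context: For probability measures $P,Q$ on $(\mathbb{R},\mathcal{B}(\mathbb{R}))$ with $P$ absolutely continuous with respect to $Q$, the Kullback–Leibler divergence is $D_1(P,Q) := E_Q\left[\frac{dP}{dQ}\log\frac{dP}{dQ}\right]$ (with $0\log 0=0$); if $P$ is not absolutely continuous with respect to $Q$, then $D_1(P,Q):=\infty$. The supremum is over all Borel probability measures $P$ on $\mathbb{R}$. A distribution function is identified with the probability measure it induces. For $\gamma\in\mathbb{R}$, the extreme value distribution is $G_\gamma(x) := \exp\left(-(1+\gamma x)^{-1/\gamma}\right)$ for $1+\gamma x>0$, interpreted as $\exp(-\exp(-x))$ when $\gamma=0$ (outside $\{1+\gamma x>0\}$, $G_\gamma$ is extended as a distribution function: $0$ if $\gamma>0$, $1$ if $\gamma<0$). A distribution function $F$ belongs to the (maximum) domain of attraction of $G_\gamma$ if there are constants $a_n>0$, $b_n\in\mathbb{R}$ and $a>0$, $b\in\mathbb{R}$ such that $\lim_{n\to\infty}F^n(a_nx+b_n)=G_\gamma(ax+b)$ for every continuity point $x$ of the limit. *)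

theory Defs
  imports "HOL-Probability.Probability"
begin

text \<open>
  The library's \<open>KL_divergence\<close> is real-valued and returns \<open>0\<close> when the integral diverges, so
  the extended-valued divergence is defined here. As \<open>t * ln t \<ge> - exp (-1)\<close> for \<open>t \<ge> 0\<close>, the
  negative part of the integrand is always integrable under a probability measure \<open>Q\<close>; if the
  integrand is not integrable, its expectation is therefore \<open>\<infinity>\<close>. Since \<open>ln 0 = 0\<close>, the
  convention \<open>0 * ln 0 = 0\<close> is built in. Note the argument order of the library:
  \<open>absolutely_continuous Q P\<close> says that \<open>P\<close> is absolutely
  continuous with respect to \<open>Q\<close>, and \<open>RN_deriv Q P\<close> is \<open>dP/dQ\<close>.
\<close>
definition kl_div :: "real measure \<Rightarrow> real measure \<Rightarrow> ereal" where
  "kl_div P Q =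
    (let f = (\<lambda>x. enn2real (RN_deriv Q P x) * ln (enn2real (RN_deriv Q P x)))
     in if absolutely_continuous Q P \<and> integrable Q f
        then ereal (\<integral>x. f x \<partial>Q) else \<infinity>)"

definition extreme_value_df :: "real \<Rightarrow> real \<Rightarrow> real" where
  "extreme_value_df \<gamma> x =
    (if \<gamma> = 0 then exp (- exp (- x))
     else if 1 + \<gamma> * x > 0 then exp (- ((1 + \<gamma> * x) powr (- 1 / \<gamma>)))
     else if \<gamma> > 0 then 0 else 1)"

text \<open>Membership includes that \<open>F\<close> is the distribution function of a Borel probability measure.\<close>
definition in_max_domain_of_attraction :: "(real \<Rightarrow> real) \<Rightarrow> real \<Rightarrow> bool" where
  "in_max_domain_of_attraction F \<gamma> \<longleftrightarrow>
    (\<exists>M. real_distribution M \<and> F = cdf M) \<and>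
    (\<exists>(a :: nat \<Rightarrow> real) (b :: nat \<Rightarrow> real) (c :: real) (d :: real).
       (\<forall>n. a n > 0) \<and> c > 0 \<and>
       (\<forall>x. isCont (\<lambda>y. extreme_value_df \<gamma> (c * y + d)) x \<longrightarrow>
            (\<lambda>n. F (a n * x + b n) ^ n) \<longlonglongrightarrow> extreme_value_df \<gamma> (c * x + d)))"

text \<open>
  The supremum is over a nonempty set of reals in \<open>{0..1}\<close> when \<open>\<delta> \<ge> 0\<close>
  (the reference measure itself is admissible), so the real-valued supremum is the proper one.
\<close>
definition worst_case_tail :: "real \<Rightarrow> real \<Rightarrow> real" where
  "worst_case_tail \<delta> x =
    Sup {measure P {x<..} | P.
           real_distribution P \<and> kl_div P (interval_measure (extreme_value_df 0)) \<le> ereal \<delta>}"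

definition worst_case_df :: "real \<Rightarrow> real \<Rightarrow> real" where
  "worst_case_df \<delta> x = 1 - worst_case_tail \<delta> x"

end

theory Submission imports Defs "HOL-Real_Asymp.Real_Asymp" begin

text \<open>
  Write \<open>T x\<close> for the worst-case tail at \<open>x\<close> and \<open>q = G\<^sub>0{x<..} = 1 - exp (- exp (- x))\<close>. The core of the
  argument is that \<open>x * T x \<longlongrightarrow> \<delta>\<close> as \<open>x \<rightarrow> \<infinity>\<close> (\<open>worst_case_tail_asymp\<close>): the tail is regularly varying
  with index \<open>-1\<close>, hence attracted to the Frechet law \<open>exp (- 1 / x)\<close>, which is \<open>G\<^sub>1\<close> shifted by one.

  The upper bound is a form of the variational principle of Donsker and Varadhan. Integrating Young's
  inequality \<open>t * u \<le> t * ln t - t + exp u\<close>, with \<open>t = dP/dQ\<close> and \<open>u = s * indicator A\<close>, gives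
  \<open>s * P(A) \<le> \<delta> + Q(A) * (exp s - 1)\<close> for every \<open>P\<close> in the divergence ball
  (\<open>measure_le_of_kl_div_le\<close>). For \<open>A = {x<..}\<close> and \<open>s = x - sqrt x\<close> the last term vanishes in the
  limit, while \<open>s\<close> is asymptotic to \<open>x\<close>.

  The lower bound comes from reweighting \<open>G\<^sub>0\<close> by one constant on \<open>{x<..}\<close> and another one on its
  complement. If this gives \<open>{x<..}\<close> the mass \<open>p\<close>, then the divergence is that of the Bernoulli laws with
  parameters \<open>p\<close> and \<open>q\<close> (\<open>ex_real_distribution_kl_div_binary\<close>), which is at most
  \<open>p * ln (1 / q) - ln (1 - q) = p * ln (1 / q) + exp (- x)\<close>; as \<open>1 / q \<le> exp x + 1\<close>, one may take
  \<open>p = (\<delta> - exp (- x)) / ln (exp x + 1)\<close>.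

  That \<open>1 - T\<close> is a distribution function needs no formula for \<open>T\<close>: being a supremum of antitone
  right-continuous functions, \<open>T\<close> is antitone and right-continuous; it tends to \<open>1\<close> at \<open>-\<infinity>\<close> because
  \<open>T \<ge> q\<close>, and to \<open>0\<close> at \<open>\<infinity>\<close> by the asymptotics above.
\<close>

section \<open>The Gumbel law\<close>

text \<open>The law with distribution function \<open>G\<^sub>0\<close>.\<close>

abbreviation gumbel :: "real measure" where
  "gumbel \<equiv> interval_measure (extreme_value_df 0)"

lemma real_distribution_gumbel: "real_distribution gumbel"
  and cdf_gumbel: "cdf gumbel x = exp (- exp (- x))"
proof -
  have mono: "extreme_value_df 0 x \<le> extreme_value_df 0 y" if "x \<le> y" for x y
    using that by (simp add: extreme_value_df_def)
  have cont: "continuous (at_right a) (extreme_value_df 0)" for a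
    unfolding extreme_value_df_def by (auto intro!: continuous_intros)
  have bot: "(extreme_value_df 0 \<longlongrightarrow> 0) at_bot"
    unfolding extreme_value_df_def by simp real_asymp
  have top: "(extreme_value_df 0 \<longlongrightarrow> 1) at_top"
    unfolding extreme_value_df_def by simp real_asymp
  show "real_distribution gumbel"
    by (rule real_distribution_interval_measure) (fact mono cont bot top)+
  show "cdf gumbel x = exp (- exp (- x))"
    using cdf_interval_measure[of "extreme_value_df 0", OF mono cont bot]
    by (simp add: extreme_value_df_def)
qed

lemma (in real_distribution) measure_greaterThan: "measure M {x<..} = 1 - cdf M x"
proof -
  have "{x<..} = space M - {..x}" by auto
  then show ?thesis
    using prob_compl[of "{..x}"] by (simp add: cdf_def)
qed

lemma measure_gumbel_greaterThan: "measure gumbel {x<..} = 1 - exp (- exp (- x))"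
  using real_distribution.measure_greaterThan[OF real_distribution_gumbel] cdf_gumbel by simp

section \<open>The divergence of a measure given by a density\<close>

lemma kl_div_density:
  fixes h :: "real \<Rightarrow> real"
  assumes Q: "real_distribution Q" and h [measurable]: "h \<in> borel_measurable borel"
    and nonneg: "\<And>x. 0 \<le> h x" and int: "integrable Q (\<lambda>x. h x * ln (h x))"
  shows "kl_div (density Q h) Q = ereal (\<integral>x. h x * ln (h x) \<partial>Q)"
proof -
  interpret Q: real_distribution Q by fact
  let ?P = "density Q h"
  let ?f = "\<lambda>x. enn2real (RN_deriv Q ?P x) * ln (enn2real (RN_deriv Q ?P x))"
  have "AE x in Q. ennreal (h x) = RN_deriv Q ?P x"
    by (rule Q.RN_deriv_unique) auto
  then have eq: "AE x in Q. ?f x = h x * ln (h x)"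
    by (rule AE_mp) (auto intro!: AE_I2 simp: nonneg dest!: sym[where t="RN_deriv Q ?P _"])
  have ac: "absolutely_continuous Q ?P"
    by (rule absolutely_continuousI_density) auto
  have "integrable Q ?f"
    using int eq by (subst integrable_cong_AE[where g="\<lambda>x. h x * ln (h x)"]) auto
  moreover have "(\<integral>x. ?f x \<partial>Q) = (\<integral>x. h x * ln (h x) \<partial>Q)"
    using eq by (intro integral_cong_AE) auto
  ultimately show ?thesis
    using ac by (simp add: kl_div_def Let_def)
qed

lemma kl_div_self:
  assumes "real_distribution Q"
  shows "kl_div Q Q = 0"
proof -
  interpret Q: real_distribution Q by fact
  show ?thesis
    using kl_div_density[OF assms, of "\<lambda>_. 1"] by (simp add: density_1 zero_ereal_def)
qed

text \<open>
  The density of the witness is \<open>p / Q(A)\<close> on \<open>A\<close> and \<open>(1 - p) / (1 - Q(A))\<close> off \<open>A\<close>.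
\<close>

lemma ex_real_distribution_kl_div_binary:
  fixes p :: real
  assumes Q: "real_distribution Q" and A: "A \<in> sets borel"
    and q: "0 < measure Q A" "measure Q A < 1" and p: "0 \<le> p" "p \<le> 1"
  shows "\<exists>P. real_distribution P \<and> measure P A = p \<and>
           kl_div P Q = ereal (p * ln (p / measure Q A) + (1 - p) * ln ((1 - p) / (1 - measure Q A)))"
proof -
  interpret Q: real_distribution Q by fact
  define q where "q = measure Q A"
  define a where "a = p / q"
  define b where "b = (1 - p) / (1 - q)"
  define h where "h x = (if x \<in> A then a else b)" for x
  have q': "0 < q" "q < 1" using assms by (auto simp: q_def)
  have ab: "0 \<le> a" "0 \<le> b" using q' p by (auto simp: a_def b_def)
  have A' [measurable]: "A \<in> sets borel" by fact
  have hm [measurable]: "h \<in> borel_measurable borel" unfolding h_def by measurable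
  have h0: "0 \<le> h x" for x using ab by (simp add: h_def)
  have compl: "measure Q (- A) = 1 - q"
    using Q.prob_compl[of A] A by (simp add: q_def Compl_eq_Diff_UNIV)
  \<comment> \<open>Both the normalisation and the divergence are integrals of two-valued functions.\<close>
  have two: "integrable Q (\<lambda>x. if x \<in> A then c else d)"
    "(\<integral>x. (if x \<in> A then c else d) \<partial>Q) = c * q + d * (1 - q)" for c d :: real
  proof -
    have *: "(\<lambda>x. if x \<in> A then c else d) = (\<lambda>x. c * indicator A x + d * indicator (- A) x)"
      by (auto simp: indicator_def)
    show "integrable Q (\<lambda>x. if x \<in> A then c else d)"
      unfolding * using A
      by (intro Bochner_Integration.integrable_add integrable_mult_right)
         (auto simp: Q.emeasure_eq_measure)
    show "(\<integral>x. (if x \<in> A then c else d) \<partial>Q) = c * q + d * (1 - q)"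
      unfolding * using A compl
      by (subst Bochner_Integration.integral_add) (auto simp: Q.emeasure_eq_measure q_def)
  qed
  let ?P = "density Q h"
  have em: "emeasure ?P B = ennreal (\<integral>x. h x * indicator B x \<partial>Q)" if [measurable]: "B \<in> sets borel" for B
  proof -
    have "emeasure ?P B = (\<integral>\<^sup>+x. ennreal (h x * indicator B x) \<partial>Q)"
      by (subst emeasure_density) (auto intro!: nn_integral_cong simp: indicator_def)
    also have "\<dots> = ennreal (\<integral>x. h x * indicator B x \<partial>Q)"
      using h0 two(1)[of a b]
      by (intro nn_integral_eq_integral integrable_real_mult_indicator) (auto simp: h_def[abs_def])
    finally show ?thesis .
  qed
  have "emeasure ?P (space ?P) = 1"
    using em[of UNIV] two(2)[of a b] q' by (simp add: h_def[abs_def] a_def b_def)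
  then have P: "real_distribution ?P"
    by (auto intro!: prob_spaceI simp: real_distribution_def real_distribution_axioms_def)
  have "emeasure ?P A = ennreal (\<integral>x. (if x \<in> A then a else 0) \<partial>Q)"
    by (subst em) (auto intro!: arg_cong[where f=ennreal] Bochner_Integration.integral_cong
        simp: h_def A indicator_def)
  then have "emeasure ?P A = ennreal p"
    using two(2)[of a 0] q' by (simp add: a_def)
  then have mP: "measure ?P A = p" using p by (simp add: measure_def)
  have hl: "(\<lambda>x. h x * ln (h x)) = (\<lambda>x. if x \<in> A then a * ln a else b * ln b)"
    by (auto simp: h_def)
  have "kl_div ?P Q = ereal (a * ln a * q + b * ln b * (1 - q))"
    using kl_div_density[OF Q hm h0] two[of "a * ln a" "b * ln b"] by (simp add: hl)
  also have "a * ln a * q + b * ln b * (1 - q) = p * ln (p / q) + (1 - p) * ln ((1 - p) / (1 - q))"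
    using q' by (simp add: a_def b_def)
  finally show ?thesis
    using P mP unfolding q_def by blast
qed

section \<open>An upper bound for probabilities on a divergence ball\<close>

text \<open>Convex duality between \<open>exp u\<close> and \<open>t * ln t - t\<close>.\<close>

lemma Young_exp_ln:
  fixes s t :: real
  assumes "0 \<le> t"
  shows "t * s \<le> t * ln t - t + exp s"
proof (cases "t = 0")
  case False
  with assms have t: "0 < t" by simp
  have "t * (1 + (s - ln t)) \<le> t * exp (s - ln t)"
    using t exp_ge_add_one_self by (intro mult_left_mono) auto
  also have "\<dots> = exp s" using t by (simp add: exp_diff)
  finally show ?thesis by (simp add: algebra_simps)
qed auto

lemma measure_le_of_kl_div_le:
  assumes P: "real_distribution P" and Q: "real_distribution Q"
    and kl: "kl_div P Q \<le> ereal \<delta>" and A [measurable]: "A \<in> sets borel"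
  shows "s * measure P A \<le> \<delta> + measure Q A * (exp s - 1)"
proof -
  interpret P: real_distribution P by fact
  interpret Q: real_distribution Q by fact
  define t where "t x = enn2real (RN_deriv Q P x)" for x
  have ac: "absolutely_continuous Q P" and int: "integrable Q (\<lambda>x. t x * ln (t x))"
    and le: "(\<integral>x. t x * ln (t x) \<partial>Q) \<le> \<delta>"
    using kl by (auto simp: kl_div_def Let_def t_def[abs_def] split: if_splits)
  have sets: "sets P = sets Q" by simp
  \<comment> \<open>Change of measure: an integral under \<open>P\<close> is the integral under \<open>Q\<close> weighted by \<open>t\<close>.\<close>
  note RN = Q.RN_deriv_integrable[OF P.sigma_finite_measure_axioms ac sets]
    Q.RN_deriv_integral[OF P.sigma_finite_measure_axioms ac sets]
  have ti: "integrable Q t" and t1: "(\<integral>x. t x \<partial>Q) = 1"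
    using RN[of "\<lambda>_. 1"] P.prob_space by (auto simp: t_def[abs_def])
  have iP: "integrable P (indicator A :: real \<Rightarrow> real)"
    by (auto simp: P.emeasure_eq_measure)
  have tAi: "integrable Q (\<lambda>x. t x * indicator A x)"
    and tA: "(\<integral>x. t x * indicator A x \<partial>Q) = measure P A"
    using RN[of "indicator A"] iP by (auto simp: t_def[abs_def])
  have iQ: "integrable Q (indicator A :: real \<Rightarrow> real)"
    by (auto simp: Q.emeasure_eq_measure)
  have e: "exp (s * indicator A x) = 1 + (exp s - 1) * indicator A x" for x
    by (auto simp: indicator_def)
  have "(\<integral>x. s * (t x * indicator A x) \<partial>Q)
      \<le> (\<integral>x. t x * ln (t x) - t x + (1 + (exp s - 1) * indicator A x) \<partial>Q)"
  proof (rule integral_mono)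
    fix x
    show "s * (t x * indicator A x) \<le> t x * ln (t x) - t x + (1 + (exp s - 1) * indicator A x)"
      using Young_exp_ln[of "t x" "s * indicator A x"] unfolding e
      by (simp add: t_def mult_ac)
  qed (use int ti tAi iQ in auto)
  also have "\<dots> = (\<integral>x. t x * ln (t x) \<partial>Q) - 1 + (1 + (exp s - 1) * measure Q A)"
    using int ti iQ t1 Q.prob_space by simp
  finally show ?thesis
    using le tA by (simp add: algebra_simps)
qed

section \<open>The worst-case tail\<close>

lemma measure_le_worst_case_tail:
  assumes "real_distribution P" "kl_div P gumbel \<le> ereal \<delta>"
  shows "measure P {x<..} \<le> worst_case_tail \<delta> x"
  unfolding worst_case_tail_def
proof (rule cSup_upper)
  show "bdd_above {measure P {x<..} | P. real_distribution P \<and> kl_div P gumbel \<le> ereal \<delta>}"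
    by (rule bdd_aboveI[of _ 1])
       (auto simp: real_distribution_def intro: prob_space.prob_le_1)
qed (use assms in auto)

lemma kl_div_gumbel_self_le: "0 \<le> \<delta> \<Longrightarrow> kl_div gumbel gumbel \<le> ereal \<delta>"
  by (simp add: kl_div_self real_distribution_gumbel)

lemma worst_case_tail_le:
  assumes "0 \<le> \<delta>"
    and "\<And>P. real_distribution P \<Longrightarrow> kl_div P gumbel \<le> ereal \<delta> \<Longrightarrow> measure P {x<..} \<le> B"
  shows "worst_case_tail \<delta> x \<le> B"
  unfolding worst_case_tail_def
  using assms real_distribution_gumbel kl_div_gumbel_self_le by (intro cSup_least) auto

lemma less_worst_case_tailD:
  assumes "0 \<le> \<delta>" "y < worst_case_tail \<delta> x"
  obtains P where "real_distribution P" "kl_div P gumbel \<le> ereal \<delta>" "y < measure P {x<..}"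
  using worst_case_tail_le[OF assms(1), of x y] assms(2) by (meson not_le)

lemma worst_case_tail_antimono:
  assumes "0 \<le> \<delta>" "x \<le> y"
  shows "worst_case_tail \<delta> y \<le> worst_case_tail \<delta> x"
proof (rule worst_case_tail_le[OF assms(1)])
  fix P assume P: "real_distribution P" "kl_div P gumbel \<le> ereal \<delta>"
  interpret P: real_distribution P by fact
  have "measure P {y<..} \<le> measure P {x<..}"
    using assms(2) by (intro P.finite_measure_mono) auto
  also have "\<dots> \<le> worst_case_tail \<delta> x"
    by (rule measure_le_worst_case_tail) fact+
  finally show "measure P {y<..} \<le> worst_case_tail \<delta> x" .
qed

lemma worst_case_tail_le_1: "0 \<le> \<delta> \<Longrightarrow> worst_case_tail \<delta> x \<le> 1"
  by (rule worst_case_tail_le) (auto simp: real_distribution_def intro: prob_space.prob_le_1)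

lemma gumbel_tail_le_worst_case_tail:
  "0 \<le> \<delta> \<Longrightarrow> 1 - exp (- exp (- x)) \<le> worst_case_tail \<delta> x"
  using measure_le_worst_case_tail[OF real_distribution_gumbel kl_div_gumbel_self_le]
  by (simp add: measure_gumbel_greaterThan)

text \<open>
  Only lower semicontinuity has content: a law that nearly attains the supremum at \<open>a\<close> still has almost
  the same tail slightly to the right of \<open>a\<close>.
\<close>

lemma worst_case_tail_tendsto_at_right:
  assumes "0 \<le> \<delta>"
  shows "(worst_case_tail \<delta> \<longlongrightarrow> worst_case_tail \<delta> a) (at_right a)"
proof (rule order_tendstoI)
  fix y assume "y < worst_case_tail \<delta> a"
  then obtain P where P: "real_distribution P" "kl_div P gumbel \<le> ereal \<delta>" "y < measure P {a<..}"
    using less_worst_case_tailD[OF assms] by blast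
  interpret P: real_distribution P by fact
  have "((\<lambda>x. measure P {x<..}) \<longlongrightarrow> measure P {a<..}) (at_right a)"
    unfolding P.measure_greaterThan
    using P.cdf_is_right_cont[of a] by (intro tendsto_intros) (simp add: continuous_within)
  then have "\<forall>\<^sub>F x in at_right a. y < measure P {x<..}"
    using P(3) by (rule order_tendstoD)
  then show "\<forall>\<^sub>F x in at_right a. y < worst_case_tail \<delta> x"
    by eventually_elim (use measure_le_worst_case_tail[OF P(1,2)] in \<open>meson less_le_trans\<close>)
next
  fix y assume "worst_case_tail \<delta> a < y"
  then show "\<forall>\<^sub>F x in at_right a. worst_case_tail \<delta> x < y"
    using worst_case_tail_antimono[OF assms]
    by (auto simp: eventually_at_filter intro!: always_eventually) (meson le_less_trans less_imp_le)
qed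

lemma worst_case_tail_upper:
  assumes "0 \<le> \<delta>" "0 < s"
  shows "worst_case_tail \<delta> x \<le> (\<delta> + exp (s - x)) / s"
proof (rule worst_case_tail_le[OF assms(1)])
  fix P assume P: "real_distribution P" "kl_div P gumbel \<le> ereal \<delta>"
  have "s * measure P {x<..} \<le> \<delta> + (1 - exp (- exp (- x))) * (exp s - 1)"
    using measure_le_of_kl_div_le[OF P(1) real_distribution_gumbel P(2), of "{x<..}" s]
    by (simp add: measure_gumbel_greaterThan)
  also have "(1 - exp (- exp (- x))) * (exp s - 1) \<le> exp (- x) * exp s"
    using exp_ge_add_one_self[of "- exp (- x)"] assms(2) by (intro mult_mono) auto
  also have "\<dots> = exp (s - x)" by (simp flip: exp_add)
  finally show "measure P {x<..} \<le> (\<delta> + exp (s - x)) / s"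
    using assms(2) by (simp add: field_simps)
qed

text \<open>
  The condition \<open>exp (- x) \<le> \<delta>\<close> makes the left-hand side nonnegative, and \<open>\<delta> \<le> x\<close> keeps it at most
  one, so that it can serve as a probability.
\<close>

lemma worst_case_tail_lower:
  assumes "exp (- x) \<le> \<delta>" "\<delta> \<le> x"
  shows "(\<delta> - exp (- x)) / ln (exp x + 1) \<le> worst_case_tail \<delta> x"
proof -
  define q where "q = measure gumbel {x<..}"
  define p where "p = (\<delta> - exp (- x)) / ln (exp x + 1)"
  have q_eq: "q = 1 - exp (- exp (- x))" by (simp add: q_def measure_gumbel_greaterThan)
  have q: "0 < q" "q < 1" by (auto simp: q_eq)
  have L: "x \<le> ln (exp x + 1)" "0 < ln (exp x + 1)"
    by (auto simp: ln_ge_iff add_pos_pos)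
  have "\<delta> - exp (- x) \<le> ln (exp x + 1)"
    using assms(2) L(1) exp_gt_zero[of "- x"] by linarith
  then have p: "0 \<le> p" "p \<le> 1"
    using assms(1) L(2) by (auto simp: p_def divide_le_eq_1_pos)
  have "exp (- exp (- x)) = 1 / exp (exp (- x))"
    by (simp add: exp_minus inverse_eq_divide)
  also have "\<dots> \<le> 1 / (1 + exp (- x))"
    using exp_ge_add_one_self[of "exp (- x)"] by (intro frac_le) (auto simp: add_pos_pos)
  also have "\<dots> = exp x / (exp x + 1)"
  proof -
    have "1 + exp (- x) = (exp x + 1) / exp x"
      by (simp add: exp_minus inverse_eq_divide add_divide_distrib)
    then show ?thesis by simp
  qed
  also have "\<dots> = 1 - 1 / (exp x + 1)"
  proof -
    have "exp x + 1 \<noteq> 0" using exp_gt_zero[of x] by linarith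
    then show ?thesis by (simp add: field_simps)
  qed
  finally have "1 / (exp x + 1) \<le> q" by (simp add: q_eq)
  then have "1 / q \<le> exp x + 1"
    using q by (simp add: divide_simps add_pos_pos mult.commute split: if_splits)
  then have lq: "ln (1 / q) \<le> ln (exp x + 1)"
    using q by (intro ln_mono) auto
  \<comment> \<open>The terms \<open>p * ln p\<close> and \<open>(1 - p) * ln (1 - p)\<close> are nonpositive and can be dropped.\<close>
  have entropy1: "p * ln (p / q) \<le> p * ln (1 / q)"
  proof (cases "p = 0")
    case False
    then show ?thesis
      using p q by (intro mult_left_mono ln_mono divide_right_mono) auto
  qed simp
  have entropy2: "(1 - p) * ln ((1 - p) / (1 - q)) \<le> exp (- x)"
  proof (cases "p = 1")
    case False
    with p have "p < 1" by simp
    then have "ln ((1 - p) / (1 - q)) \<le> ln (1 / (1 - q))"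
      using p q by (intro ln_mono divide_right_mono) auto
    also have "\<dots> = exp (- x)"
      by (simp add: q_eq ln_div)
    finally have "(1 - p) * ln ((1 - p) / (1 - q)) \<le> (1 - p) * exp (- x)"
      using p by (intro mult_left_mono) auto
    also have "\<dots> \<le> exp (- x)" using p by (simp add: mult_left_le_one_le)
    finally show ?thesis .
  qed simp
  have "p * ln (p / q) + (1 - p) * ln ((1 - p) / (1 - q)) \<le> p * ln (exp x + 1) + exp (- x)"
    using entropy1 entropy2 mult_left_mono[OF lq p(1)] by linarith
  also have "\<dots> = \<delta>" using L by (simp add: p_def)
  finally have le: "p * ln (p / q) + (1 - p) * ln ((1 - p) / (1 - q)) \<le> \<delta>" .
  obtain P where P: "real_distribution P" "measure P {x<..} = p"
    "kl_div P gumbel = ereal (p * ln (p / q) + (1 - p) * ln ((1 - p) / (1 - q)))"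
    using ex_real_distribution_kl_div_binary[OF real_distribution_gumbel, of "{x<..}" p] p q
    unfolding q_def by auto
  then show ?thesis
    using measure_le_worst_case_tail[of P \<delta> x] le by (simp add: p_def)
qed

lemma worst_case_tail_asymp:
  assumes "0 < \<delta>"
  shows "((\<lambda>x. x * worst_case_tail \<delta> x) \<longlongrightarrow> \<delta>) at_top"
proof (rule tendsto_sandwich)
  have "\<forall>\<^sub>F x in at_top. exp (- x) \<le> \<delta>"
    using assms by real_asymp
  with eventually_ge_at_top[of \<delta>]
  show "\<forall>\<^sub>F x in at_top. x * ((\<delta> - exp (- x)) / ln (exp x + 1)) \<le> x * worst_case_tail \<delta> x"
    by eventually_elim (use assms in \<open>intro mult_left_mono worst_case_tail_lower; linarith\<close>)
  \<comment> \<open>Any \<open>s\<close> with \<open>s / x \<longlongrightarrow> 1\<close> and \<open>s - x \<longlongrightarrow> -\<infinity>\<close> would do in the upper bound.\<close>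
  show "\<forall>\<^sub>F x in at_top. x * worst_case_tail \<delta> x \<le> x * ((\<delta> + exp ((x - sqrt x) - x)) / (x - sqrt x))"
    using eventually_gt_at_top[of 1]
  proof eventually_elim
    case (elim x)
    then have "sqrt x < x" by (simp add: real_less_lsqrt power2_eq_square)
    then show ?case
      using worst_case_tail_upper[of \<delta> "x - sqrt x" x] assms elim by (intro mult_left_mono) auto
  qed
  show "((\<lambda>x::real. x * ((\<delta> - exp (- x)) / ln (exp x + 1))) \<longlongrightarrow> \<delta>) at_top"
    by real_asymp
  show "((\<lambda>x::real. x * ((\<delta> + exp ((x - sqrt x) - x)) / (x - sqrt x))) \<longlongrightarrow> \<delta>) at_top"
    by real_asymp
qed

section \<open>The domain of attraction\<close>

lemma worst_case_df_is_cdf: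
  assumes "0 < \<delta>"
  shows "\<exists>M. real_distribution M \<and> worst_case_df \<delta> = cdf M"
proof -
  have \<delta>: "0 \<le> \<delta>" using assms by simp
  have mono: "worst_case_df \<delta> x \<le> worst_case_df \<delta> y" if "x \<le> y" for x y
    using worst_case_tail_antimono[OF \<delta> that] by (simp add: worst_case_df_def)
  have cont: "continuous (at_right a) (worst_case_df \<delta>)" for a
    unfolding continuous_within worst_case_df_def[abs_def]
    by (intro tendsto_intros worst_case_tail_tendsto_at_right \<delta>)
  have "(worst_case_tail \<delta> \<longlongrightarrow> 1) at_bot"
  proof (rule tendsto_sandwich)
    show "((\<lambda>x::real. 1 - exp (- exp (- x))) \<longlongrightarrow> 1) at_bot" by real_asymp
  qed (auto simp: gumbel_tail_le_worst_case_tail worst_case_tail_le_1 \<delta>)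
  then have bot: "(worst_case_df \<delta> \<longlongrightarrow> 0) at_bot"
    unfolding worst_case_df_def[abs_def] by (auto intro!: tendsto_eq_intros)
  have "((\<lambda>x. (x * worst_case_tail \<delta> x) * (1 / x)) \<longlongrightarrow> \<delta> * 0) at_top"
    by (intro tendsto_mult worst_case_tail_asymp assms) real_asymp
  moreover have "\<forall>\<^sub>F x in at_top. (x * worst_case_tail \<delta> x) * (1 / x) = worst_case_tail \<delta> x"
    using eventually_gt_at_top[of 0] by eventually_elim simp
  ultimately have "(worst_case_tail \<delta> \<longlongrightarrow> 0) at_top"
    by (simp add: tendsto_cong)
  then have top: "(worst_case_df \<delta> \<longlongrightarrow> 1) at_top"
    unfolding worst_case_df_def[abs_def] by (auto intro!: tendsto_eq_intros)
  show ?thesis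
    using real_distribution_interval_measure[of "worst_case_df \<delta>", OF mono cont bot top]
      cdf_interval_measure[of "worst_case_df \<delta>", OF mono cont bot] by metis
qed

text \<open>
  The sandwich \<open>exp (- u / (1 - u)) \<le> 1 - u \<le> exp (- u)\<close> for \<open>u < 1\<close>, raised to the power \<open>n\<close>.
\<close>

lemma one_minus_power_tendsto_exp:
  fixes u :: "nat \<Rightarrow> real"
  assumes "(\<lambda>n. real n * u n) \<longlonglongrightarrow> L"
  shows "(\<lambda>n. (1 - u n) ^ n) \<longlonglongrightarrow> exp (- L)"
proof -
  have "(\<lambda>n. (real n * u n) * (1 / real n)) \<longlonglongrightarrow> L * 0"
    by (intro tendsto_mult assms) real_asymp
  moreover have "\<forall>\<^sub>F n in sequentially. (real n * u n) * (1 / real n) = u n"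
    using eventually_gt_at_top[of 0] by eventually_elim simp
  ultimately have u: "u \<longlonglongrightarrow> 0" by (simp add: tendsto_cong)
  then have small: "\<forall>\<^sub>F n in sequentially. u n < 1"
    by (rule order_tendstoD) simp
  show ?thesis
  proof (rule tendsto_sandwich)
    show "\<forall>\<^sub>F n in sequentially. exp (- ((real n * u n) / (1 - u n))) \<le> (1 - u n) ^ n"
      using small
    proof eventually_elim
      case (elim n)
      have "1 / (1 - u n) \<le> exp (u n / (1 - u n))"
        using exp_ge_add_one_self[of "u n / (1 - u n)"] elim by (simp add: field_simps)
      then have "exp (- (u n / (1 - u n))) \<le> 1 - u n"
        using elim by (simp add: exp_minus field_simps)
      then have "exp (- (u n / (1 - u n))) ^ n \<le> (1 - u n) ^ n"
        by (intro power_mono) auto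
      then show ?case by (simp flip: exp_of_nat_mult)
    qed
    show "\<forall>\<^sub>F n in sequentially. (1 - u n) ^ n \<le> exp (- (real n * u n))"
      using small
    proof eventually_elim
      case (elim n)
      have "(1 - u n) ^ n \<le> exp (- u n) ^ n"
        using exp_ge_add_one_self[of "- u n"] elim by (intro power_mono) auto
      then show ?case by (simp flip: exp_of_nat_mult)
    qed
    have "(\<lambda>n. exp (- ((real n * u n) / (1 - u n)))) \<longlonglongrightarrow> exp (- (L / (1 - 0)))"
      by (intro tendsto_exp tendsto_minus tendsto_divide tendsto_diff tendsto_const assms u) simp
    then show "(\<lambda>n. exp (- ((real n * u n) / (1 - u n)))) \<longlonglongrightarrow> exp (- L)"
      by simp
    show "(\<lambda>n. exp (- (real n * u n))) \<longlonglongrightarrow> exp (- L)"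
      using assms by (intro tendsto_intros)
  qed
qed

theorem proposition8:
  fixes \<delta> :: real
  assumes "\<delta> > 0"
  shows "in_max_domain_of_attraction (worst_case_df \<delta>) 1"
proof -
  have \<delta>: "0 \<le> \<delta>" using assms by simp
  \<comment> \<open>The successor keeps the norming constant positive at \<open>n = 0\<close>.\<close>
  define a where "a n = \<delta> * real (Suc n)" for n
  have a: "0 < a n" for n using assms by (simp add: a_def)
  \<comment> \<open>With scale \<open>1\<close> and shift \<open>-1\<close>, the limit is \<open>exp (- 1 / x)\<close> for \<open>x > 0\<close> and \<open>0\<close> for \<open>x \<le> 0\<close>.\<close>
  have lim: "(\<lambda>n. worst_case_df \<delta> (a n * x + 0) ^ n) \<longlonglongrightarrow> extreme_value_df 1 (1 * x + - 1)" for x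
  proof (cases "0 < x")
    case True
    have "filterlim (\<lambda>n. a n * x) at_top sequentially"
      using assms True unfolding a_def by real_asymp
    then have "(\<lambda>n. (a n * x) * worst_case_tail \<delta> (a n * x)) \<longlonglongrightarrow> \<delta>"
      using worst_case_tail_asymp[OF assms] filterlim_compose by blast
    moreover have "(\<lambda>n. real n / (a n * x)) \<longlonglongrightarrow> 1 / (\<delta> * x)"
      using assms True unfolding a_def by (real_asymp simp: field_simps)
    ultimately have "(\<lambda>n. (real n / (a n * x)) * ((a n * x) * worst_case_tail \<delta> (a n * x)))
        \<longlonglongrightarrow> 1 / (\<delta> * x) * \<delta>"
      by (intro tendsto_mult)
    moreover have "(real n / (a n * x)) * ((a n * x) * worst_case_tail \<delta> (a n * x))
        = real n * worst_case_tail \<delta> (a n * x)" for n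
      using a[of n] True by simp
    ultimately have "(\<lambda>n. real n * worst_case_tail \<delta> (a n * x)) \<longlonglongrightarrow> 1 / x"
      using assms by simp
    from one_minus_power_tendsto_exp[OF this] show ?thesis
      using True by (simp add: worst_case_df_def extreme_value_df_def powr_minus_divide)
  next
    case False
    \<comment> \<open>Here \<open>a n * x \<le> 0\<close>, and the powers of a distribution function value below one vanish.\<close>
    have "worst_case_df \<delta> 0 < 1"
      using gumbel_tail_le_worst_case_tail[OF \<delta>, of 0]
      by (simp add: worst_case_df_def) (smt (verit) exp_less_one_iff)
    moreover have nonneg: "0 \<le> worst_case_df \<delta> y" for y
      using worst_case_tail_le_1[OF \<delta>] by (simp add: worst_case_df_def)
    ultimately have pow: "(\<lambda>n. worst_case_df \<delta> 0 ^ n) \<longlonglongrightarrow> 0"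
      by (intro LIMSEQ_power_zero) simp
    have "worst_case_df \<delta> (a n * x) ^ n \<le> worst_case_df \<delta> 0 ^ n" for n
      using worst_case_tail_antimono[OF \<delta>, of "a n * x" 0] a[of n] False nonneg
      by (intro power_mono) (auto simp: worst_case_df_def mult_nonneg_nonpos)
    moreover have "0 \<le> worst_case_df \<delta> (a n * x) ^ n" for n
      using nonneg by (rule zero_le_power)
    ultimately have "(\<lambda>n. worst_case_df \<delta> (a n * x) ^ n) \<longlonglongrightarrow> 0"
      by (intro tendsto_sandwich[OF _ _ tendsto_const pow] always_eventually allI)
    then show ?thesis using False by (simp add: extreme_value_df_def)
  qed
  show ?thesis
    unfolding in_max_domain_of_attraction_def
  proof (intro conjI)
    show "\<exists>M. real_distribution M \<and> worst_case_df \<delta> = cdf M"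
      by (rule worst_case_df_is_cdf) fact
    show "\<exists>(a :: nat \<Rightarrow> real) (b :: nat \<Rightarrow> real) (c :: real) (d :: real).
       (\<forall>n. a n > 0) \<and> c > 0 \<and>
       (\<forall>x. isCont (\<lambda>y. extreme_value_df 1 (c * y + d)) x \<longrightarrow>
            (\<lambda>n. worst_case_df \<delta> (a n * x + b n) ^ n) \<longlonglongrightarrow> extreme_value_df 1 (c * x + d))"
      by (rule exI[of _ a], rule exI[of _ "\<lambda>_. 0"], rule exI[of _ 1], rule exI[of _ "- 1"])
         (intro conjI allI impI a zero_less_one lim)
  qed
qed

end
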